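(* Let $\mathcal X_N=\{x_1,\dots,x_N\}\subset\mathcal X$ be a finite set of design points, let $\dot\Theta_2^{(0)}\subset\Theta_2$ be a nonempty finite set (a finite discretization of $\Theta_2$), let $\xi^{(0)}\in\Xi(\mathcal X_N)$ be an initial design, and let $(\xi^{(s)})_{s\in\mathbb N}$ be a sequence of designs on $\mathcal X_N$ generated by the DISC-MD procedure (defined in the context, run without stopping) from these data. Assume that the design $\xi^{(s)}$ is regular for every $s\ge 0$ (in particular the initial design $\xi^{(0)}$ is regular), i.e. the least-squares problem $\min_{\theta_2\in\Theta_2}T(\xi^{(s)},\theta_2)$ has a unique minimizer. Then every accumulation point of the sequence $(\xi^{(s)})_{s\in\mathbb N}$ is a T-optimal design on $\mathcal X_N$.
   Context: Setting. $\mathcal X\subseteq\mathbb R^{d_x}$ is nonempty and compact (design space); $\Theta_2\subseteq\mathbb R^{d_\theta}$ is nonempty, compact and convex (parameter space); $f_1:\mathcal X\to\mathbb R$ (a model with fixed parameters) and $f_2:\mathcal X\times\Theta_2\to\mathbb R$ are continuous. Put $\varphi(x,\theta_2)=[f_1(x)-f_2(x,\theta_2)]^2$. Designs. For a compact set $\mathcal X'\subseteq\mathcal X$, $\Xi(\mathcal X')$ is the set of (Borel) probability measures on $\mathcal X'$, called designs on $\mathcal X'$. For a design $\xi$ put $T(\xi,\theta_2)=\int\varphi(x,\theta_2)\,\xi(dx)$ and $T(\xi)=\min_{\theta_2\in\Theta_2}T(\xi,\theta_2)$. A design is T-optimal on $\mathcal X'$ if it maximizes $T$ over $\Xi(\mathcal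 X')$. A design $\xi$ is regular if $\theta_2\mapsto T(\xi,\theta_2)$ has a unique minimizer on $\Theta_2$. Designs on the finite set $\mathcal X_N=\{x_1,\dots,x_N\}$ are identified with weight vectors $w\in\mathbb R^N$, $w\ge0$, $\sum_i w_i=1$; accumulation points are taken in $\mathbb R^N$. DISC-MD procedure. Given $\mathcal X_N$, an initial design $\xi^{(0)}$ on $\mathcal X_N$ and a finite set $\dot\Theta_2^{(0)}\subset\Theta_2$, for $s=0,1,2,\dots$: (1) let $w^{(s+1)}$ be the $w$-part of an optimal solution $(w,t)$ of the linear program: maximize $t$ over $(w,t)\in\mathbb R^N\times\mathbb R$ subject to $\sum_{i=1}^N w_i\varphi(x_i,\theta_2)\ge t$ for all $\theta_2\in\dot\Theta_2^{(s)}$, $\sum_{i=1}^N w_i=1$, $w\ge 0$; let $\xi^{(s+1)}$ be the design on $\mathcal X_N$ with weights $w^{(s+1)}$; (2) let $\hat\theta_2^{(s+1)}$ be a minimizer over $\Theta_2$ of $\theta_2\mapsto\sum_{i=1}^N w_i^{(s+1)}\varphi(x_i,\theta_2)$; (3) set $\dot\Theta_2^{(s+1)}=\dot\Theta_2^{(s)}\cup\{\hat\theta_2^{(s+1)}\}$. *)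

theory Defs
  imports "HOL-Analysis.Analysis" "HOL-Probability.Probability_Measure"
begin

definition sq_dist :: "('x \<Rightarrow> real) \<Rightarrow> ('x \<Rightarrow> 'p \<Rightarrow> real) \<Rightarrow> 'x \<Rightarrow> 'p \<Rightarrow> real" where
  "sq_dist f1 f2 x \<theta> = (f1 x - f2 x \<theta>)\<^sup>2"

definition designs :: "'x::topological_space set \<Rightarrow> 'x measure set" where
  "designs X' = {\<xi>. prob_space \<xi> \<and> space \<xi> = X' \<and> sets \<xi> = sets (restrict_space borel X')}"

definition T_at :: "('x \<Rightarrow> real) \<Rightarrow> ('x \<Rightarrow> 'p \<Rightarrow> real) \<Rightarrow> 'x measure \<Rightarrow> 'p \<Rightarrow> real" where
  "T_at f1 f2 \<xi> \<theta> = (LINT x|\<xi>. sq_dist f1 f2 x \<theta>)"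

text \<open>The infimum below is a minimum whenever the parameter set is nonempty and compact and
  the models are continuous on a compact design space.\<close>

definition T_crit :: "('x \<Rightarrow> real) \<Rightarrow> ('x \<Rightarrow> 'p \<Rightarrow> real) \<Rightarrow> 'p set \<Rightarrow> 'x measure \<Rightarrow> real" where
  "T_crit f1 f2 \<Theta>2 \<xi> = (INF \<theta>\<in>\<Theta>2. T_at f1 f2 \<xi> \<theta>)"

definition T_optimal ::
  "('x::topological_space \<Rightarrow> real) \<Rightarrow> ('x \<Rightarrow> 'p \<Rightarrow> real) \<Rightarrow> 'p set \<Rightarrow> 'x set \<Rightarrow> 'x measure \<Rightarrow> bool" where
  "T_optimal f1 f2 \<Theta>2 X' \<xi> \<longleftrightarrow>
     \<xi> \<in> designs X' \<and> (\<forall>\<eta>\<in>designs X'. T_crit f1 f2 \<Theta>2 \<eta> \<le> T_crit f1 f2 \<Theta>2 \<xi>)"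

definition regular_design ::
  "('x \<Rightarrow> real) \<Rightarrow> ('x \<Rightarrow> 'p \<Rightarrow> real) \<Rightarrow> 'p set \<Rightarrow> 'x measure \<Rightarrow> bool" where
  "regular_design f1 f2 \<Theta>2 \<xi> \<longleftrightarrow> (\<exists>!\<theta>. is_arg_min (T_at f1 f2 \<xi>) (\<lambda>\<theta>. \<theta> \<in> \<Theta>2) \<theta>)"

definition weight_vectors :: "(real^'n) set" where
  "weight_vectors = {w. (\<forall>i. 0 \<le> w $ i) \<and> (\<Sum>i\<in>UNIV. w $ i) = 1}"

text \<open>The design on the finite set \<^term>\<open>range x\<close> that gives mass \<^term>\<open>w $ i\<close> to \<^term>\<open>x i\<close>.
  It is meant for \<^term>\<open>w \<in> weight_vectors\<close> only: \<^const>\<open>ennreal\<close> truncates negative weights.\<close>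

definition design_of_weights :: "('n::finite \<Rightarrow> 'x::topological_space) \<Rightarrow> real^'n \<Rightarrow> 'x measure" where
  "design_of_weights x w =
     distr (point_measure UNIV (\<lambda>i. ennreal (w $ i))) (restrict_space borel (range x)) x"

lemma design_of_weights_in_designs:
  assumes "w \<in> weight_vectors"
  shows "design_of_weights x w \<in> designs (range x)"
proof -
  let ?P = "point_measure UNIV (\<lambda>i. ennreal (w $ i))"
  have "emeasure ?P UNIV = (\<Sum>i\<in>UNIV. ennreal (w $ i))"
    by (rule emeasure_point_measure_finite) auto
  also have "\<dots> = 1"
    using assms by (simp add: weight_vectors_def)
  finally have "prob_space ?P"
    by (intro prob_spaceI) (simp add: space_point_measure)
  moreover have "x \<in> measurable ?P (restrict_space borel (range x))"
    by (simp add: space_restrict_space)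
  ultimately show ?thesis
    by (auto simp: designs_def design_of_weights_def space_restrict_space
        intro: prob_space.prob_space_distr)
qed

lemma sets_restrict_space_range_finite:
  fixes x :: "'n::finite \<Rightarrow> 'x::t1_space"
  shows "sets (restrict_space borel (range x)) = Pow (range x)"
proof
  show "Pow (range x) \<subseteq> sets (restrict_space borel (range x))"
  proof
    fix A assume A: "A \<in> Pow (range x)"
    then have "A \<in> sets borel"
      by (intro borel_closed finite_imp_closed) (auto intro: finite_subset)
    then have "range x \<inter> A \<in> sets (restrict_space borel (range x))"
      by (auto simp: sets_restrict_space)
    then show "A \<in> sets (restrict_space borel (range x))"
      using A by (simp add: Int_absorb1)
  qed
qed (auto simp: sets_restrict_space)

lemma T_at_design_of_weights:
  fixes x :: "'n::finite \<Rightarrow> 'x::t1_space"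
  assumes w: "w \<in> weight_vectors"
  shows "T_at f1 f2 (design_of_weights x w) \<theta> = (\<Sum>i\<in>UNIV. w $ i * sq_dist f1 f2 (x i) \<theta>)"
proof -
  have "x \<in> measurable (point_measure UNIV (\<lambda>i. ennreal (w $ i))) (restrict_space borel (range x))"
    by (simp add: space_restrict_space)
  moreover have "(\<lambda>y. sq_dist f1 f2 y \<theta>) \<in> borel_measurable (restrict_space borel (range x))"
    by (auto simp: measurable_def space_restrict_space sets_restrict_space_range_finite)
  ultimately show ?thesis
    using w unfolding T_at_def design_of_weights_def
    by (subst integral_distr)
      (auto simp: weight_vectors_def lebesgue_integral_point_measure_finite)
qed

lemma bij_betw_design_of_weights:
  fixes x :: "'n::finite \<Rightarrow> 'x::t1_space"
  assumes inj: "inj x"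
  shows "bij_betw (design_of_weights x) weight_vectors (designs (range x))"
proof -
  note sets_range = sets_restrict_space_range_finite[of x]
  have mass: "emeasure (design_of_weights x w) {x i} = ennreal (w $ i)" for w i
  proof -
    have "x -` {x i} = {i}"
      using inj by (auto dest: injD)
    then show ?thesis
      unfolding design_of_weights_def
      by (subst emeasure_distr)
        (auto simp: space_restrict_space sets_range space_point_measure
          emeasure_point_measure_finite)
  qed
  show ?thesis
    unfolding bij_betw_def
  proof (intro conjI inj_onI equalityI subsetI)
    fix v w :: "real^'n"
    assume "v \<in> weight_vectors" "w \<in> weight_vectors"
      and eq: "design_of_weights x v = design_of_weights x w"
    then have "v $ i = w $ i" for i
      using mass[of v i] mass[of w i] by (auto simp: weight_vectors_def)
    then show "v = w"
      by (simp add: vec_eq_iff)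
  next
    fix \<xi> assume "\<xi> \<in> design_of_weights x ` weight_vectors"
    then show "\<xi> \<in> designs (range x)"
      by (auto simp: design_of_weights_in_designs)
  next
    fix \<xi> assume \<xi>: "\<xi> \<in> designs (range x)"
    then interpret prob_space \<xi>
      by (simp add: designs_def)
    have sp: "space \<xi> = range x" and st: "sets \<xi> = Pow (range x)"
      using \<xi> sets_range by (auto simp: designs_def)
    define w :: "real^'n" where "w = (\<chi> i. measure \<xi> {x i})"
    have "(\<Sum>i\<in>UNIV. measure \<xi> {x i}) = (\<Sum>y\<in>range x. measure \<xi> {y})"
      using inj by (simp add: sum.reindex)
    also have "\<dots> = measure \<xi> (range x)"
      using st by (intro finite_measure_eq_sum_singleton[symmetric]) auto
    finally have "w \<in> weight_vectors"
      using prob_space sp by (simp add: w_def weight_vectors_def)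
    moreover have "\<xi> = design_of_weights x w"
    proof (rule measure_eqI_finite)
      show "sets \<xi> = Pow (range x)" by (fact st)
      show "sets (design_of_weights x w) = Pow (range x)"
        by (simp add: design_of_weights_def sets_range)
      show "emeasure \<xi> {a} = emeasure (design_of_weights x w) {a}" if "a \<in> range x" for a
        using that by (auto simp: mass w_def emeasure_eq_measure)
    qed simp
    ultimately show "\<xi> \<in> design_of_weights x ` weight_vectors"
      by blast
  qed
qed

definition lp_feasible ::
  "('x \<Rightarrow> 'p \<Rightarrow> real) \<Rightarrow> ('n::finite \<Rightarrow> 'x) \<Rightarrow> 'p set \<Rightarrow> real^'n \<Rightarrow> real \<Rightarrow> bool" where
  "lp_feasible \<phi> x D w t \<longleftrightarrow>
     (\<forall>\<theta>\<in>D. (\<Sum>i\<in>UNIV. w $ i * \<phi> (x i) \<theta>) \<ge> t) \<and> (\<Sum>i\<in>UNIV. w $ i) = 1 \<and> (\<forall>i. 0 \<le> w $ i)"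

definition lp_optimal ::
  "('x \<Rightarrow> 'p \<Rightarrow> real) \<Rightarrow> ('n::finite \<Rightarrow> 'x) \<Rightarrow> 'p set \<Rightarrow> real^'n \<Rightarrow> real \<Rightarrow> bool" where
  "lp_optimal \<phi> x D w t \<longleftrightarrow>
     lp_feasible \<phi> x D w t \<and> (\<forall>w' t'. lp_feasible \<phi> x D w' t' \<longrightarrow> t' \<le> t)"

text \<open>A run of the procedure: \<^term>\<open>w s\<close> are the weights of the \<^term>\<open>s\<close>-th design,
  \<^term>\<open>D s\<close> is the \<^term>\<open>s\<close>-th discretization of the parameter set, and \<^term>\<open>\<theta>h s\<close> is the
  parameter computed in step \<^term>\<open>s\<close> (so \<^term>\<open>\<theta>h 0\<close> is irrelevant).\<close>

definition disc_md ::
  "('x \<Rightarrow> 'p \<Rightarrow> real) \<Rightarrow> 'p set \<Rightarrow> ('n::finite \<Rightarrow> 'x) \<Rightarrow> real^'n \<Rightarrow> 'p set \<Rightarrow>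
   (nat \<Rightarrow> real^'n) \<Rightarrow> (nat \<Rightarrow> 'p) \<Rightarrow> (nat \<Rightarrow> 'p set) \<Rightarrow> bool" where
  "disc_md \<phi> \<Theta>2 x w0 D0 w \<theta>h D \<longleftrightarrow>
     w 0 = w0 \<and> D 0 = D0 \<and>
     (\<forall>s. (\<exists>t. lp_optimal \<phi> x (D s) (w (Suc s)) t) \<and>
          is_arg_min (\<lambda>\<theta>. \<Sum>i\<in>UNIV. w (Suc s) $ i * \<phi> (x i) \<theta>) (\<lambda>\<theta>. \<theta> \<in> \<Theta>2) (\<theta>h (Suc s)) \<and>
          D (Suc s) = D s \<union> {\<theta>h (Suc s)})"

definition seq_accumulation_point :: "(nat \<Rightarrow> 'a::topological_space) \<Rightarrow> 'a \<Rightarrow> bool" where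
  "seq_accumulation_point u l \<longleftrightarrow> (\<exists>r. strict_mono r \<and> (u \<circ> r) \<longlonglongrightarrow> l)"

end

theory Submission
  imports Defs
begin

text \<open>
  This is the convergence argument for cutting-plane methods. Write
  \<open>G v \<theta> = (\<Sum>i\<in>UNIV. v $ i * \<phi> (x i) \<theta>)\<close>, let \<open>v\<close> be any weight vector, and let \<open>m\<close> be its
  criterion value, the infimum of \<open>G v\<close> over all parameters. Since \<open>(v, m)\<close> is feasible for every
  one of the linear programs, each iterate \<open>w\<^sub>s\<close> satisfies \<open>G w\<^sub>s \<theta> \<ge> m\<close> at all discretization
  points known when it was computed, in particular at all earlier least-squares estimates
  \<open>\<theta>\<^sub>j\<close>, \<open>j < s\<close> (lemma \<open>disc_md_cut\<close>).

  Suppose that \<open>w\<^sub>s\<close> tends to \<open>w\<^sub>*\<close> along a subsequence. By compactness one may also assume that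
  \<open>\<theta>\<^sub>s\<close> tends to some \<open>\<theta>\<^sub>*\<close>. Letting first \<open>s\<close> and then \<open>j\<close> tend to infinity in \<open>G w\<^sub>s \<theta>\<^sub>j \<ge> m\<close> gives
  \<open>G w\<^sub>* \<theta>\<^sub>* \<ge> m\<close>. As \<open>\<theta>\<^sub>s\<close> minimizes \<open>G w\<^sub>s\<close>, the limit \<open>\<theta>\<^sub>*\<close> minimizes \<open>G w\<^sub>*\<close>, so the criterion value
  of \<open>w\<^sub>*\<close> is \<open>G w\<^sub>* \<theta>\<^sub>*\<close> and hence at least \<open>m\<close> (lemma \<open>cutting_plane_accumulation_bound\<close>).
  Every design on the finite set of design points is given by some such \<open>v\<close>, which makes
  \<open>w\<^sub>*\<close> optimal.
\<close>

lemma seq_accumulation_point_Suc: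
  assumes "seq_accumulation_point u l"
  shows "seq_accumulation_point (\<lambda>s. u (Suc s)) l"
proof -
  obtain r where r: "strict_mono r" "(u \<circ> r) \<longlonglongrightarrow> l"
    using assms by (auto simp: seq_accumulation_point_def)
  define q where "q k = r (Suc k) - 1" for k
  have "0 < r (Suc k)" for k
    using strict_monoD[OF r(1), of k "Suc k"] by simp
  then have Suc_q: "Suc (q k) = r (Suc k)" for k
    by (simp add: q_def)
  have "strict_mono q"
    unfolding strict_mono_Suc_iff
  proof
    fix k
    have "Suc (q k) < Suc (q (Suc k))"
      unfolding Suc_q using r(1) by (simp add: strict_mono_Suc_iff)
    then show "q k < q (Suc k)"
      by simp
  qed
  moreover have "((\<lambda>s. u (Suc s)) \<circ> q) \<longlonglongrightarrow> l"
    using LIMSEQ_Suc[OF r(2)] by (simp add: o_def Suc_q)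
  ultimately show ?thesis
    by (auto simp: seq_accumulation_point_def)
qed

lemma seq_accumulation_point_in_closed:
  assumes "seq_accumulation_point u l" and "closed S" and "\<And>s. u s \<in> S"
  shows "l \<in> S"
proof -
  obtain r where "(u \<circ> r) \<longlonglongrightarrow> l"
    using assms(1) by (auto simp: seq_accumulation_point_def)
  then show ?thesis
    using assms(2,3) by (rule_tac closed_sequentially[where f = "u \<circ> r"]) auto
qed

text \<open>The cuts control \<open>g l\<close> only at the points \<open>th s\<close>. They suffice because a limit point of
  \<open>th\<close> is a minimizer of \<open>g l\<close>: the bound is inherited by that one point, and from there by all
  of \<open>S\<close>.\<close>

lemma cutting_plane_accumulation_bound:
  fixes g :: "'a::topological_space \<Rightarrow> 'b::metric_space \<Rightarrow> real"
  assumes S: "compact S"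
    and cont: "continuous_on (W \<times> S) (\<lambda>(v, \<theta>). g v \<theta>)"
    and u: "\<And>s. u s \<in> W" and l: "l \<in> W"
    and acc: "seq_accumulation_point u l"
    and th: "\<And>s. is_arg_min (g (u s)) (\<lambda>\<theta>. \<theta> \<in> S) (th s)"
    and cut: "\<And>j s. j < s \<Longrightarrow> m \<le> g (u s) (th j)"
    and \<theta>: "\<theta> \<in> S"
  shows "m \<le> g l \<theta>"
proof -
  have th_S: "th s \<in> S" for s
    using th by (simp add: is_arg_min_def)
  have th_le: "g (u s) (th s) \<le> g (u s) \<theta>" for s
    using th[of s] \<theta> by (auto simp: is_arg_min_linorder)
  obtain r where r: "strict_mono r" "(u \<circ> r) \<longlonglongrightarrow> l"
    using acc by (auto simp: seq_accumulation_point_def)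
  obtain \<theta>' q where \<theta>': "\<theta>' \<in> S" and q: "strict_mono q" and lim_th: "((th \<circ> r) \<circ> q) \<longlonglongrightarrow> \<theta>'"
    using S th_S unfolding compact_eq_seq_compact_metric
    by (elim seq_compactE[where f = "th \<circ> r"]) auto
  define p where "p = r \<circ> q"
  have p: "strict_mono p"
    using r(1) q by (simp add: p_def strict_mono_o)
  have lim_th: "(\<lambda>k. th (p k)) \<longlonglongrightarrow> \<theta>'"
    using lim_th by (simp add: p_def o_def)
  have lim_u: "(\<lambda>k. u (p k)) \<longlonglongrightarrow> l"
    using LIMSEQ_subseq_LIMSEQ[OF r(2) q] by (simp add: p_def o_def)
  have lim_g: "(\<lambda>k. g (a k) (b k)) \<longlonglongrightarrow> g a' b'"
    if "a \<longlonglongrightarrow> a'" "b \<longlonglongrightarrow> b'" "\<And>k. a k \<in> W" "a' \<in> W" "\<And>k. b k \<in> S" "b' \<in> S" for a b a' b'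
    using continuous_on_tendsto_compose[OF cont tendsto_Pair[OF that(1,2)]] that(3-6) by simp
  have "m \<le> g l (th (p j))" for j
  proof (rule LIMSEQ_le_const)
    show "(\<lambda>k. g (u (p k)) (th (p j))) \<longlonglongrightarrow> g l (th (p j))"
      by (rule lim_g[OF lim_u]) (auto simp: u l th_S)
    show "\<exists>N. \<forall>k\<ge>N. m \<le> g (u (p k)) (th (p j))"
      using cut strict_monoD[OF p] by (intro exI[of _ "Suc j"]) auto
  qed
  then have "m \<le> g l \<theta>'"
    by (intro LIMSEQ_le_const[OF lim_g[OF tendsto_const lim_th]]) (auto simp: l \<theta>' th_S)
  also have "g l \<theta>' \<le> g l \<theta>"
    by (rule LIMSEQ_le[OF lim_g[OF lim_u lim_th] lim_g[OF lim_u tendsto_const]])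
      (auto simp: u l th_S \<theta>' \<theta> th_le)
  finally show ?thesis .
qed

lemma T_crit_le_T_at:
  assumes "\<theta> \<in> \<Theta>2"
  shows "T_crit f1 f2 \<Theta>2 \<xi> \<le> T_at f1 f2 \<xi> \<theta>"
  unfolding T_crit_def
proof (rule cINF_lower[OF _ assms])
  show "bdd_below (T_at f1 f2 \<xi> ` \<Theta>2)"
    by (rule bdd_belowI[of _ 0])
      (auto simp: T_at_def sq_dist_def intro!: Bochner_Integration.integral_nonneg)
qed

lemma continuous_on_weighted_sq_dist:
  fixes f2 :: "'x::topological_space \<Rightarrow> 'p::topological_space \<Rightarrow> real"
  assumes "continuous_on (X \<times> \<Theta>2) (\<lambda>(y, \<theta>). f2 y \<theta>)" and "range x \<subseteq> X"
  shows "continuous_on (W \<times> \<Theta>2) (\<lambda>(v :: real^'n, \<theta>). \<Sum>i\<in>UNIV. v $ i * sq_dist f1 f2 (x i) \<theta>)"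
proof -
  have "continuous_on (W \<times> \<Theta>2) (\<lambda>z. f2 (x i) (snd z))" for i
  proof -
    have "continuous_on (W \<times> \<Theta>2) (\<lambda>z. (\<lambda>(y, \<theta>). f2 y \<theta>) (x i, snd z))"
      using assms(2)
      by (intro continuous_on_compose2[OF assms(1)] continuous_intros) auto
    then show ?thesis
      by simp
  qed
  then show ?thesis
    unfolding case_prod_beta sq_dist_def by (intro continuous_intros)
qed

lemma closed_weight_vectors: "closed (weight_vectors :: (real^'n) set)"
  unfolding weight_vectors_def
  by (intro closed_Collect_conj closed_Collect_all closed_Collect_le closed_Collect_eq
      continuous_intros)

lemma disc_md_weight_vectors:
  assumes "disc_md \<phi> \<Theta>2 x w0 D0 w \<theta>h D"
  shows "w (Suc s) \<in> weight_vectors"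
  using assms by (force simp: disc_md_def lp_optimal_def lp_feasible_def weight_vectors_def)

lemma disc_md_mono:
  assumes "disc_md \<phi> \<Theta>2 x w0 D0 w \<theta>h D" and "s \<le> s'"
  shows "D s \<subseteq> D s'"
  using assms(1) by (intro lift_Suc_mono_le[OF _ assms(2)]) (auto simp: disc_md_def)

lemma disc_md_subset:
  assumes "disc_md \<phi> \<Theta>2 x w0 D0 w \<theta>h D" and "D0 \<subseteq> \<Theta>2"
  shows "D s \<subseteq> \<Theta>2"
  using assms by (induction s) (auto simp: disc_md_def is_arg_min_def)

text \<open>The pair \<open>(v, m)\<close> is feasible for the linear program over every discretization, so the
  optimal value, which the next iterate attains, never drops below \<open>m\<close>.\<close>

lemma disc_md_cut:
  assumes run: "disc_md \<phi> \<Theta>2 x w0 D0 w \<theta>h D" and "D0 \<subseteq> \<Theta>2"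
    and v: "v \<in> weight_vectors"
    and m: "\<And>\<theta>. \<theta> \<in> \<Theta>2 \<Longrightarrow> m \<le> (\<Sum>i\<in>UNIV. v $ i * \<phi> (x i) \<theta>)"
    and "j < s"
  shows "m \<le> (\<Sum>i\<in>UNIV. w (Suc s) $ i * \<phi> (x i) (\<theta>h (Suc j)))"
proof -
  obtain t where t: "lp_optimal \<phi> x (D s) (w (Suc s)) t"
    using run by (auto simp: disc_md_def)
  have "lp_feasible \<phi> x (D s) v m"
    using v m disc_md_subset[OF run \<open>D0 \<subseteq> \<Theta>2\<close>, of s]
    by (auto simp: lp_feasible_def weight_vectors_def)
  then have "m \<le> t"
    using t by (auto simp: lp_optimal_def)
  moreover have "\<theta>h (Suc j) \<in> D s"
    using run disc_md_mono[OF run, of "Suc j" s] \<open>j < s\<close> by (auto simp: disc_md_def)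
  ultimately show ?thesis
    using t by (force simp: lp_optimal_def lp_feasible_def)
qed

theorem theorem10:
  fixes X :: "(real^'dx) set" and \<Theta>2 :: "(real^'dt) set"
    and f1 :: "real^'dx \<Rightarrow> real" and f2 :: "real^'dx \<Rightarrow> real^'dt \<Rightarrow> real"
    and x :: "'n::finite \<Rightarrow> real^'dx"
    and w0 :: "real^'n" and D0 :: "(real^'dt) set"
    and w :: "nat \<Rightarrow> real^'n" and \<theta>h :: "nat \<Rightarrow> real^'dt" and D :: "nat \<Rightarrow> (real^'dt) set"
    and w_acc :: "real^'n"
  assumes "X \<noteq> {}" and "compact X"
    and "\<Theta>2 \<noteq> {}" and "compact \<Theta>2" and "convex \<Theta>2"
    and "continuous_on X f1"
    and "continuous_on (X \<times> \<Theta>2) (\<lambda>(y, \<theta>). f2 y \<theta>)"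
    and "inj x" and "range x \<subseteq> X"
    and "D0 \<noteq> {}" and "finite D0" and "D0 \<subseteq> \<Theta>2"
    and "w0 \<in> weight_vectors"
    and "disc_md (sq_dist f1 f2) \<Theta>2 x w0 D0 w \<theta>h D"
    and "\<And>s. regular_design f1 f2 \<Theta>2 (design_of_weights x (w s))"
    and "seq_accumulation_point w w_acc"
  shows "T_optimal f1 f2 \<Theta>2 (range x) (design_of_weights x w_acc)"
proof -
  let ?G = "\<lambda>v \<theta>. \<Sum>i\<in>UNIV. v $ i * sq_dist f1 f2 (x i) \<theta>"
  note run = \<open>disc_md (sq_dist f1 f2) \<Theta>2 x w0 D0 w \<theta>h D\<close>
  (* The iterates solve a linear program from index 1 on; hence the shift. *)
  have acc: "seq_accumulation_point (\<lambda>s. w (Suc s)) w_acc"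
    using \<open>seq_accumulation_point w w_acc\<close> by (rule seq_accumulation_point_Suc)
  have w_acc: "w_acc \<in> weight_vectors"
    using acc closed_weight_vectors disc_md_weight_vectors[OF run]
    by (rule seq_accumulation_point_in_closed)
  have "T_crit f1 f2 \<Theta>2 \<eta> \<le> T_crit f1 f2 \<Theta>2 (design_of_weights x w_acc)"
    if \<eta>: "\<eta> \<in> designs (range x)" for \<eta>
  proof -
    obtain v where v: "v \<in> weight_vectors" "\<eta> = design_of_weights x v"
      using \<eta> bij_betw_imp_surj_on[OF bij_betw_design_of_weights[OF \<open>inj x\<close>]] by blast
    define m where "m = T_crit f1 f2 \<Theta>2 \<eta>"
    have m: "m \<le> ?G v \<theta>" if "\<theta> \<in> \<Theta>2" for \<theta>
      using T_crit_le_T_at[OF that, of f1 f2 \<eta>] v by (simp add: m_def T_at_design_of_weights)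
    have "m \<le> ?G w_acc \<theta>" if "\<theta> \<in> \<Theta>2" for \<theta>
    proof (rule cutting_plane_accumulation_bound[where g = ?G and W = UNIV
          and u = "\<lambda>s. w (Suc s)" and th = "\<lambda>s. \<theta>h (Suc s)" and S = \<Theta>2])
      show "continuous_on (UNIV \<times> \<Theta>2) (\<lambda>(v, \<theta>). ?G v \<theta>)"
        using continuous_on_weighted_sq_dist assms(7) \<open>range x \<subseteq> X\<close> .
      show "is_arg_min (?G (w (Suc s))) (\<lambda>\<theta>. \<theta> \<in> \<Theta>2) (\<theta>h (Suc s))" for s
        using run by (simp add: disc_md_def)
      show "m \<le> ?G (w (Suc s)) (\<theta>h (Suc j))" if "j < s" for j s
        using disc_md_cut[OF run \<open>D0 \<subseteq> \<Theta>2\<close> v(1) m that] .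
    qed (use \<open>compact \<Theta>2\<close> acc that in auto)
    then show ?thesis
      using \<open>\<Theta>2 \<noteq> {}\<close> w_acc unfolding T_crit_def[of _ _ _ "design_of_weights x w_acc"]
      by (intro cINF_greatest) (auto simp: m_def T_at_design_of_weights)
  qed
  then show ?thesis
    using w_acc by (simp add: T_optimal_def design_of_weights_in_designs)
qed

end
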